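(* Every (normalized) Laurent polynomial $f\in\mathbb{C}[N]$, $N\cong\mathbb{Z}^2$, is mutation equivalent to a Laurent polynomial $g$ for which there exists a lattice point $v\in\Delta(g)$ with $\varphi_m(v)\le 0$ for every $m\in\mathcal{M}(g)$.
   Context: $M=\operatorname{Hom}(N,\mathbb{Z})$, $\widetilde M=M\oplus\mathbb{Z}$ with projections $\pi_M,\pi_{\mathbb{Z}}$, $R^*=(0,1)$. For $m\in\widetilde M$, $\varphi_m(n)=\langle\pi_M(m),n\rangle+\pi_{\mathbb{Z}}(m)$, and $(\pi_M(m)=0)=\{n:\langle\pi_M(m),n\rangle=0\}$. Laurent polynomials are normalized: coefficient $1$ at every vertex of the Newton polytope $\Delta(\cdot)$. For $g$ with $\Delta(g)\subset(\pi_M(m)=0)$, $f$ is $(m,g)$-mutable if $f=\sum_{i\in\mathbb{Z}}f_i$ with $f_i$ supported on $(\varphi_m=i)\cap N$ and $f_i$ divisible by $g^i$ (in the Laurent polynomial ring) for all $i\ge 0$; then $\operatorname{mut}^g_mf=\sum_if_i/g^i$. $f$ is $m$-mutable if $m\neq kR^*$ for all $k\in\mathbb{Z}$ and $f$ is $(m,g)$-mutable for some $g$ with $\Delta(g)\subset(\pi_M(m)=0)$ a lattice segment of lattice length $1$. $\mathcal{M}(f)=\{m\in\widetilde M: f\text{ is }m\text{-mutable}\}$. $f$ and $h$ are mutation equivalent if $h$ is obtained from $f$ by a finite sequence of mutations $\operatorname{mut}^{g}_{m}$, each applied to a polynomial that is $(m,g)$-mutable with $\Delta(g)$ a lattice segment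 of length $1$ in $(\pi_M(m)=0)$, $m\ne kR^*$. *)

theory Defs
  imports "HOL-Analysis.Analysis"
begin

text \<open>Lattice N = Z^2 (pairs of integers), dual lattice M = Z^2 with the standard pairing,
  Mtilde = M x Z.  Laurent polynomials in C[N] are finitely supported functions N \<Rightarrow> complex.\<close>

type_synonym latN = "int \<times> int"
type_synonym latM = "int \<times> int"
type_synonym latMt = "latM \<times> int"
type_synonym lpoly = "latN \<Rightarrow> complex"

definition pairing :: "latM \<Rightarrow> latN \<Rightarrow> int" where
  "pairing u n = fst u * fst n + snd u * snd n"

definition phi :: "latMt \<Rightarrow> latN \<Rightarrow> int" where
  "phi m n = pairing (fst m) n + snd m"

definition supp :: "lpoly \<Rightarrow> latN set" where
  "supp f = {n. f n \<noteq> 0}"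

definition is_lpoly :: "lpoly \<Rightarrow> bool" where
  "is_lpoly f \<longleftrightarrow> finite (supp f)"

definition lmult :: "lpoly \<Rightarrow> lpoly \<Rightarrow> lpoly" where
  "lmult f g = (\<lambda>n. \<Sum>a\<in>supp f. f a * g (fst n - fst a, snd n - snd a))"

definition lone :: lpoly where
  "lone = (\<lambda>n. if n = (0, 0) then 1 else 0)"

primrec lpow :: "lpoly \<Rightarrow> nat \<Rightarrow> lpoly" where
  "lpow g 0 = lone"
| "lpow g (Suc k) = lmult g (lpow g k)"

definition lsum :: "'i set \<Rightarrow> ('i \<Rightarrow> lpoly) \<Rightarrow> lpoly" where
  "lsum I F = (\<lambda>n. \<Sum>i\<in>I. F i n)"

definition to_real :: "latN \<Rightarrow> real \<times> real" where
  "to_real n = (real_of_int (fst n), real_of_int (snd n))"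

definition newton :: "lpoly \<Rightarrow> (real \<times> real) set" where
  "newton f = convex hull (to_real ` supp f)"

definition normalized :: "lpoly \<Rightarrow> bool" where
  "normalized f \<longleftrightarrow> (\<forall>v. to_real v extreme_point_of newton f \<longrightarrow> f v = 1)"

definition ker_hyp :: "latMt \<Rightarrow> (real \<times> real) set" where
  "ker_hyp m = {x. real_of_int (fst (fst m)) * fst x + real_of_int (snd (fst m)) * snd x = 0}"

definition unit_segment :: "lpoly \<Rightarrow> bool" where
  "unit_segment g \<longleftrightarrow> (\<exists>p q. p \<noteq> q \<and> newton g = convex hull {to_real p, to_real q}
      \<and> gcd (fst q - fst p) (snd q - snd p) = 1)"

definition piece :: "lpoly \<Rightarrow> latMt \<Rightarrow> int \<Rightarrow> lpoly" where
  "piece f m i = (\<lambda>n. if phi m n = i then f n else 0)"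

definition ldvd :: "lpoly \<Rightarrow> lpoly \<Rightarrow> bool" where
  "ldvd g f \<longleftrightarrow> (\<exists>h. is_lpoly h \<and> f = lmult g h)"

definition mutable_wrt :: "latMt \<Rightarrow> lpoly \<Rightarrow> lpoly \<Rightarrow> bool" where
  "mutable_wrt m g f \<longleftrightarrow> (\<forall>i\<ge>0. ldvd (lpow g (nat i)) (piece f m i))"

definition admissible :: "latMt \<Rightarrow> lpoly \<Rightarrow> bool" where
  "admissible m g \<longleftrightarrow> (\<forall>k::int. m \<noteq> ((0, 0), k)) \<and> is_lpoly g \<and> normalized g
      \<and> unit_segment g \<and> newton g \<subseteq> ker_hyp m"

text \<open>h = mut^g_m f: hs i is the quotient f_i / g^i for i \<ge> 0 (unique, since C[N] is a
  domain); for i < 0 the piece is f_i * g^(-i).\<close>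
definition is_mutation :: "latMt \<Rightarrow> lpoly \<Rightarrow> lpoly \<Rightarrow> lpoly \<Rightarrow> bool" where
  "is_mutation m g f h \<longleftrightarrow> (\<exists>hs :: int \<Rightarrow> lpoly.
      (\<forall>i\<ge>0. is_lpoly (hs i) \<and> piece f m i = lmult (lpow g (nat i)) (hs i)) \<and>
      h = lsum (phi m ` supp f)
            (\<lambda>i. if i \<ge> 0 then hs i else lmult (piece f m i) (lpow g (nat (- i)))))"

definition mut_step :: "lpoly \<Rightarrow> lpoly \<Rightarrow> bool" where
  "mut_step f h \<longleftrightarrow> (\<exists>m g. admissible m g \<and> mutable_wrt m g f \<and> is_mutation m g f h)"

definition mutation_equivalent :: "lpoly \<Rightarrow> lpoly \<Rightarrow> bool" where
  "mutation_equivalent f h \<longleftrightarrow> mut_step\<^sup>*\<^sup>* f h"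

definition m_mutable :: "lpoly \<Rightarrow> latMt \<Rightarrow> bool" where
  "m_mutable f m \<longleftrightarrow> (\<exists>g. admissible m g \<and> mutable_wrt m g f)"

definition mutability_set :: "lpoly \<Rightarrow> latMt set" where
  "mutability_set f = {m. m_mutable f m}"

end

(*
  Mutating in a direction u and then
  back in the direction -u, with shifted affine parts, multiplies f by (1 + x^w)^j, where w is
  primitive and orthogonal to u, and j >= 0 is arbitrary. Choose w far from the differences of
  exponents of f, so that u separates the exponents, and let j be half of the width of f in
  direction u. If m is mutable for the product and phi_m attains a maximum t > 0, then the face
  where it does is an edge of lattice length at least t. Such an edge is either parallel to w and
  has length j, or is a translate of an edge of f and hence short compared with j. The point in the
  middle of the long strip newton f + [0, j] w has lattice distance at least the length of the
  edge from every edge, so phi_m is nonpositive there.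
*)

theory Submission
  imports Defs "HOL-Computational_Algebra.Polynomial"
begin

section \<open>Laurent polynomials supported on a line\<close>

definition ray :: "latN \<Rightarrow> latN \<Rightarrow> nat \<Rightarrow> latN" where
  "ray d a l = (fst a + int l * fst d, snd a + int l * snd d)"

text \<open>For $d \neq 0$ the sum has at most one term, and \<open>emb d a P\<close> is the Laurent polynomial
  $x^a P(x^d)$.\<close>

definition emb :: "latN \<Rightarrow> latN \<Rightarrow> complex poly \<Rightarrow> lpoly" where
  "emb d a P n = (\<Sum>l | n = ray d a l. coeff P l)"

lemma ray_inj: "d \<noteq> (0, 0) \<Longrightarrow> ray d a l = ray d a k \<longleftrightarrow> l = k"
  by (cases d) (auto simp: ray_def)

lemma emb_ray [simp]: "d \<noteq> (0, 0) \<Longrightarrow> emb d a P (ray d a l) = coeff P l"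
  by (simp add: emb_def ray_inj)

lemma emb_off_ray: "(\<And>l. n \<noteq> ray d a l) \<Longrightarrow> emb d a P n = 0"
  by (simp add: emb_def)

lemma emb_nonzeroE:
  assumes "emb d a P n \<noteq> 0" and "d \<noteq> (0, 0)"
  obtains l where "n = ray d a l" "coeff P l \<noteq> 0"
  using assms by (metis emb_off_ray emb_ray)

lemma supp_emb: "d \<noteq> (0, 0) \<Longrightarrow> supp (emb d a P) \<subseteq> ray d a ` {..degree P}"
  by (auto simp: supp_def elim!: emb_nonzeroE intro!: imageI le_degree)

lemma is_lpoly_emb: "d \<noteq> (0, 0) \<Longrightarrow> is_lpoly (emb d a P)"
  unfolding is_lpoly_def by (meson finite_atMost finite_imageI finite_subset supp_emb)

lemma coeff_binomial_power: "coeff ([:1, 1:] ^ n) l = (of_nat (n choose l) :: complex)"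
proof (cases "l \<le> n")
  case False
  then have "degree ([:1, 1::complex:] ^ n) < l"
    by (simp add: degree_linear_power)
  then show ?thesis
    using False by (simp add: coeff_eq_0 binomial_eq_0)
qed (simp add: coeff_linear_poly_power)

lemma finite_ex_maximal:
  fixes F :: "'a \<Rightarrow> int"
  assumes "finite S" and "S \<noteq> {}"
  shows "\<exists>y\<in>S. \<forall>x\<in>S. F x \<le> F y"
  using Max_in[of "F ` S"] Max_ge[of "F ` S"] assms by (metis finite_imageI imageE imageI image_is_empty)

lemma emb_sum: "emb d a (\<Sum>i\<in>I. P i) n = (\<Sum>i\<in>I. emb d a (P i) n)"
  by (simp add: emb_def coeff_sum sum.swap[of _ I])

lemma emb_monom: "d \<noteq> (0, 0) \<Longrightarrow> emb d a (monom c k) n = (if n = ray d a k then c else 0)"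
  by (cases "\<exists>l. n = ray d a l") (auto simp: ray_inj emb_off_ray)

lemma lmult_eq_sum_superset:
  assumes "finite S" and "supp F \<subseteq> S"
  shows "lmult F h n = (\<Sum>x\<in>S. F x * h (fst n - fst x, snd n - snd x))"
  unfolding lmult_def using assms by (intro sum.mono_neutral_left) (auto simp: supp_def)

lemma lmult_emb:
  assumes "d \<noteq> (0, 0)"
  shows "lmult (emb d a P) h n =
    (\<Sum>l\<le>degree P. coeff P l * h (fst n - fst (ray d a l), snd n - snd (ray d a l)))"
proof -
  have "inj_on (ray d a) {..degree P}"
    using assms by (auto simp: inj_on_def ray_inj)
  then show ?thesis
    using assms by (subst lmult_eq_sum_superset[OF _ supp_emb]) (auto simp: sum.reindex)
qed

text \<open>Expanding both factors into monomials on lines in the common direction \<open>d\<close>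
  turns the convolution into multiplication of one-variable polynomials.\<close>

lemma lmult_emb_emb:
  assumes d: "d \<noteq> (0, 0)"
  shows "lmult (emb d a P) (emb d b Q) = emb d (fst a + fst b, snd a + snd b) (P * Q)"
proof
  fix n
  let ?c = "(fst a + fst b, snd a + snd b)"
  have shift: "(fst n - fst (ray d a l), snd n - snd (ray d a l)) = ray d b r
      \<longleftrightarrow> n = ray d ?c (l + r)" for l r
    by (cases n) (auto simp: ray_def algebra_simps)
  have emb_expand: "emb d b Q k = (\<Sum>r\<le>degree Q. if k = ray d b r then coeff Q r else 0)" for k
  proof -
    have "emb d b Q k = emb d b (\<Sum>r\<le>degree Q. monom (coeff Q r) r) k"
      by (simp add: poly_as_sum_of_monoms)
    then show ?thesis
      by (simp only: emb_sum emb_monom[OF d])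
  qed
  have "P * Q = (\<Sum>l\<le>degree P. monom (coeff P l) l) * (\<Sum>r\<le>degree Q. monom (coeff Q r) r)"
    by (simp add: poly_as_sum_of_monoms)
  also have "\<dots> = (\<Sum>l\<le>degree P. \<Sum>r\<le>degree Q. monom (coeff P l * coeff Q r) (l + r))"
    by (simp add: sum_product mult_monom)
  finally have "emb d ?c (P * Q) n = (\<Sum>l\<le>degree P. \<Sum>r\<le>degree Q.
      if n = ray d ?c (l + r) then coeff P l * coeff Q r else 0)"
    by (simp only: emb_sum emb_monom[OF d])
  also have "\<dots> = (\<Sum>l\<le>degree P. coeff P l * (\<Sum>r\<le>degree Q.
      if n = ray d ?c (l + r) then coeff Q r else 0))"
    by (auto simp: sum_distrib_left intro!: sum.cong)
  also have "\<dots> = lmult (emb d a P) (emb d b Q) n"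
    unfolding lmult_emb[OF d] emb_expand shift ..
  finally show "lmult (emb d a P) (emb d b Q) n = emb d ?c (P * Q) n" ..
qed

lemma lone_eq_emb: "d \<noteq> (0, 0) \<Longrightarrow> lone = emb d (0, 0) 1"
  using emb_monom[of d "(0, 0)" 1 0] by (auto simp: lone_def ray_def fun_eq_iff)

lemma lpow_emb:
  "d \<noteq> (0, 0) \<Longrightarrow> lpow (emb d a P) k = emb d (int k * fst a, int k * snd a) (P ^ k)"
  by (induction k) (simp_all add: lone_eq_emb lmult_emb_emb algebra_simps)

lemma binomial_eq_emb:
  assumes "p \<noteq> q"
  defines "d \<equiv> (fst q - fst p, snd q - snd p)"
  assumes "supp g = {p, q}" and "g p = 1" and "g q = 1"
  shows "g = emb d p [:1, 1:]"
proof
  fix n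
  have d: "d \<noteq> (0, 0)"
    using assms(1) by (auto simp: d_def prod_eq_iff)
  have pq: "ray d p 0 = p" "ray d p 1 = q"
    by (auto simp: ray_def d_def)
  show "g n = emb d p [:1, 1:] n"
  proof (cases "n = p \<or> n = q")
    case True
    then show ?thesis
      using emb_ray[OF d, of p _ 0] emb_ray[OF d, of p _ 1] assms(4,5) pq by auto
  next
    case False
    then have "g n = 0"
      using assms(3) by (auto simp: supp_def)
    moreover have "emb d p [:1, 1:] n = 0"
    proof (rule ccontr)
      assume "emb d p [:1, 1:] n \<noteq> 0"
      then obtain l where l: "n = ray d p l" "coeff [:1, 1::complex:] l \<noteq> 0"
        using d by (rule emb_nonzeroE)
      then have "l = 0 \<or> l = 1"
        by (auto simp: coeff_pCons split: nat.splits)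
      then show False
        using False l pq by auto
    qed
    ultimately show ?thesis by simp
  qed
qed

section \<open>Admissible factors and the spread of exponents they force\<close>

lemma to_real_inj [simp]: "to_real a = to_real b \<longleftrightarrow> a = b"
  by (auto simp: to_real_def prod_eq_iff)

text \<open>A Bezout relation gives an integral functional that rises from 0 at \<open>p\<close> to
  1 at \<open>q\<close>. Its value \<open>k\<close> at \<open>n\<close> is the parameter
  \<open>r\<close>, so \<open>r\<close> is an integer.\<close>

lemma lattice_point_primitive_segment:
  assumes "gcd (fst q - fst p) (snd q - snd p) = (1::int)"
    and "to_real n \<in> convex hull {to_real p, to_real q}"
  shows "n = p \<or> n = q"
proof -
  obtain r where r: "0 \<le> r" "r \<le> 1" "to_real n = (1 - r) *\<^sub>R to_real p + r *\<^sub>R to_real q"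
    using assms(2) unfolding segment_convex_hull[symmetric] in_segment by blast
  obtain x y where xy: "x * (fst q - fst p) + y * (snd q - snd p) = (1::int)"
    using bezout_int assms(1) by metis
  define k where "k = x * (fst n - fst p) + y * (snd n - snd p)"
  have 1: "real_of_int (fst n) - fst p = r * (real_of_int (fst q) - fst p)"
    and 2: "real_of_int (snd n) - snd p = r * (real_of_int (snd q) - snd p)"
    using r(3) by (auto simp: to_real_def algebra_simps)
  have "real_of_int k = x * (r * (real_of_int (fst q) - fst p)) + y * (r * (real_of_int (snd q) - snd p))"
    unfolding k_def 1[symmetric] 2[symmetric] by simp
  also have "\<dots> = r * real_of_int (x * (fst q - fst p) + y * (snd q - snd p))"
    by (simp add: algebra_simps)
  also have "\<dots> = r"
    by (simp only: xy of_int_1 mult_1_right)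
  finally have k: "real_of_int k = r" .
  then have "k = 0 \<or> k = 1"
    using r(1,2) by auto
  then show ?thesis
    using 1 2 k by (auto simp: prod_eq_iff)
qed

lemma supp_unit_segment:
  assumes "p \<noteq> q" and "newton g = convex hull {to_real p, to_real q}"
    and "gcd (fst q - fst p) (snd q - snd p) = 1"
  shows "supp g = {p, q}"
proof
  show sub: "supp g \<subseteq> {p, q}"
  proof
    fix n assume "n \<in> supp g"
    then have "to_real n \<in> newton g"
      unfolding newton_def by (intro hull_inc) auto
    then show "n \<in> {p, q}"
      using lattice_point_primitive_segment[OF assms(3)] assms(2) by auto
  qed
  have "x \<in> supp g" if "x \<in> {p, q}" for x
  \<comment> \<open>With one end missing, the support and hence its hull would be at most one
    point.\<close>
  proof (rule ccontr)
    assume "x \<notin> supp g"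
    then have "supp g \<subseteq> {if x = p then q else p}"
      using sub that by auto
    then obtain y where "y \<noteq> x" "supp g \<subseteq> {y}"
      using assms(1) by (metis that insert_iff singletonD)
    then have "newton g \<subseteq> {to_real y}"
      unfolding newton_def by (intro hull_minimal) auto
    moreover have "to_real x \<in> newton g"
      unfolding assms(2) using that by (intro hull_inc) auto
    ultimately show False
      using \<open>y \<noteq> x\<close> by auto
  qed
  then show "{p, q} \<subseteq> supp g" by blast
qed

text \<open>A primitive segment contains no lattice points besides its ends, and normalization makes
  both end coefficients 1. So \<open>g\<close> is a monomial times \<open>1 + x^d\<close>, with
  \<open>d\<close> orthogonal to \<open>fst m\<close>.\<close>

lemma admissibleE:
  assumes "admissible m g"
  obtains p d where "d \<noteq> (0, 0)" "pairing (fst m) d = 0" "fst m \<noteq> (0, 0)"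
    "pairing (fst m) p = 0" "g = emb d p [:1, 1:]"
proof -
  have "unit_segment g" and norm: "normalized g" and ker_g: "newton g \<subseteq> ker_hyp m"
    and m0: "\<forall>k. m \<noteq> ((0, 0), k)"
    using assms by (simp_all add: admissible_def)
  then obtain p q where pq: "p \<noteq> q" "newton g = convex hull {to_real p, to_real q}"
      "gcd (fst q - fst p) (snd q - snd p) = 1"
    unfolding unit_segment_def by metis
  have "supp g = {p, q}"
    by (rule supp_unit_segment[OF pq])
  moreover have "g p = 1" "g q = 1"
    using norm unfolding normalized_def pq(2) segment_convex_hull[symmetric]
      extreme_point_of_segment by blast+
  ultimately have g: "g = emb (fst q - fst p, snd q - snd p) p [:1, 1:]"
    by (intro binomial_eq_emb pq(1))
  have "to_real p \<in> newton g" "to_real q \<in> newton g"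
    unfolding pq(2) by (auto intro: hull_inc)
  then have "to_real p \<in> ker_hyp m" "to_real q \<in> ker_hyp m"
    using ker_g by auto
  then have "real_of_int (pairing (fst m) p) = 0" "real_of_int (pairing (fst m) q) = 0"
    by (auto simp: ker_hyp_def to_real_def pairing_def)
  then have ker: "pairing (fst m) p = 0" "pairing (fst m) q = 0"
    by linarith+
  have "fst m \<noteq> (0, 0)"
    using m0 by (metis prod.collapse)
  then show ?thesis
    using that[of "(fst q - fst p, snd q - snd p)" p] pq(1) g ker
    by (auto simp: pairing_def algebra_simps prod_eq_iff)
qed

text \<open>The two extreme monomials of the product in direction $d$ come from those of the cofactor $h$
  and do not cancel.\<close>

lemma binomial_power_multiple_spread:
  assumes d: "d \<noteq> (0, 0)" and h: "is_lpoly h"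
    and F: "F = lmult (lpow (emb d p [:1, 1:]) t) h" and "F n \<noteq> 0"
  obtains z z' where "F z \<noteq> 0" "F z' \<noteq> 0" "pairing d z - pairing d z' \<ge> int t * pairing d d"
proof -
  have deg: "degree ([:1, 1:] ^ t :: complex poly) = t"
    by (simp add: degree_linear_power)
  have dd: "pairing d d > 0"
    using d by (cases d) (auto simp: pairing_def sum_squares_gt_zero_iff)
  define b where "b = (int t * fst p, int t * snd p)"
  have F_eq: "F x = (\<Sum>l\<le>t. of_nat (t choose l) *
      h (fst x - fst (ray d b l), snd x - snd (ray d b l)))" for x
    unfolding F lpow_emb[OF d] lmult_emb[OF d] deg coeff_binomial_power b_def ..
  have "supp h \<noteq> {}"
  proof
    assume "supp h = {}"
    then have "h = (\<lambda>_. 0)"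
      by (auto simp: supp_def)
    then show False
      using \<open>F n \<noteq> 0\<close> by (simp add: F_eq)
  qed
  moreover have "finite (supp h)"
    using h by (simp add: is_lpoly_def)
  ultimately obtain y y' where y: "y \<in> supp h" "\<And>x. x \<in> supp h \<Longrightarrow> pairing d x \<le> pairing d y"
    and y': "y' \<in> supp h" "\<And>x. x \<in> supp h \<Longrightarrow> - pairing d x \<le> - pairing d y'"
    using finite_ex_maximal[of "supp h" "pairing d"]
      finite_ex_maximal[of "supp h" "\<lambda>x. - pairing d x"] by metis
  define z where "z = (fst y + fst (ray d b t), snd y + snd (ray d b t))"
  define z' where "z' = (fst y' + fst b, snd y' + snd b)"
  \<comment> \<open>For \<open>l < t\<close> the argument of \<open>h\<close> pairs with
    \<open>d\<close> to more than the maximum over \<open>supp h\<close>; only the top term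
    survives.\<close>
  have "F z = (\<Sum>l\<in>{t}. of_nat (t choose l) *
      h (fst z - fst (ray d b l), snd z - snd (ray d b l)))"
    unfolding F_eq
  proof (intro sum.mono_neutral_right ballI)
    fix l assume l: "l \<in> {..t} - {t}"
    have "pairing d (fst z - fst (ray d b l), snd z - snd (ray d b l))
        = pairing d y + int (t - l) * pairing d d"
      using l by (simp add: z_def ray_def pairing_def algebra_simps of_nat_diff)
    also have "\<dots> > pairing d y"
      using l dd by simp
    finally have "(fst z - fst (ray d b l), snd z - snd (ray d b l)) \<notin> supp h"
      using y(2) by fastforce
    then show "of_nat (t choose l) * h (fst z - fst (ray d b l), snd z - snd (ray d b l)) = 0"
      by (simp add: supp_def)
  qed auto
  then have "F z \<noteq> 0"
    using y(1) by (simp add: z_def supp_def)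
  have "F z' = (\<Sum>l\<in>{0}. of_nat (t choose l) *
      h (fst z' - fst (ray d b l), snd z' - snd (ray d b l)))"
    unfolding F_eq
  proof (intro sum.mono_neutral_right ballI)
    fix l assume l: "l \<in> {..t} - {0}"
    have "pairing d (fst z' - fst (ray d b l), snd z' - snd (ray d b l))
        = pairing d y' - int l * pairing d d"
      by (simp add: z'_def ray_def pairing_def algebra_simps)
    also have "\<dots> < pairing d y'"
      using l dd by simp
    finally have "(fst z' - fst (ray d b l), snd z' - snd (ray d b l)) \<notin> supp h"
      using y'(2) by fastforce
    then show "of_nat (t choose l) * h (fst z' - fst (ray d b l), snd z' - snd (ray d b l)) = 0"
      by (simp add: supp_def)
  qed auto
  then have "F z' \<noteq> 0"
    using y'(1) by (simp add: z'_def supp_def ray_def)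
  moreover have "pairing d z - pairing d z' = int t * pairing d d + (pairing d y - pairing d y')"
    by (simp add: z_def z'_def ray_def pairing_def algebra_simps)
  ultimately show ?thesis
    using that \<open>F z \<noteq> 0\<close> y(2)[OF y'(1)] by simp
qed

text \<open>The piece at height \<open>t > 0\<close> is divisible by the \<open>t\<close>-th power
  of a binomial, so its exponents extend over at least \<open>t\<close> steps of \<open>d\<close>.
  Pairing with \<open>d\<close> itself measures one step as \<open>pairing d d\<close>.\<close>

lemma m_mutable_spread:
  assumes "m_mutable F m" and "n \<in> supp F" and "phi m n > 0"
  obtains d z z' where "d \<noteq> (0, 0)" "pairing (fst m) d = 0" "fst m \<noteq> (0, 0)"
    "z \<in> supp F" "z' \<in> supp F" "phi m z = phi m n" "phi m z' = phi m n"
    "pairing d z - pairing d z' \<ge> phi m n * pairing d d"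
proof -
  define t where "t = nat (phi m n)"
  obtain g where g: "admissible m g" "mutable_wrt m g F"
    using assms(1) unfolding m_mutable_def by blast
  obtain p d where pd: "d \<noteq> (0, 0)" "pairing (fst m) d = 0" "fst m \<noteq> (0, 0)"
      "g = emb d p [:1, 1:]"
    using g(1) by (rule admissibleE)
  obtain h where h: "is_lpoly h" "piece F m (phi m n) = lmult (lpow g t) h"
    using g(2) assms(3) unfolding mutable_wrt_def ldvd_def t_def by (meson less_imp_le)
  have "piece F m (phi m n) n \<noteq> 0"
    using assms(2) by (simp add: piece_def supp_def)
  then obtain z z' where "piece F m (phi m n) z \<noteq> 0" "piece F m (phi m n) z' \<noteq> 0"
      "pairing d z - pairing d z' \<ge> int t * pairing d d"
    using binomial_power_multiple_spread[OF pd(1) h(1) h(2)[unfolded pd(4)]] by blast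
  then show ?thesis
    using that[OF pd(1-3), of z z'] assms(3) by (auto simp: piece_def supp_def t_def split: if_splits)
qed

section \<open>Thickening along a direction that separates the exponents\<close>

text \<open>In Laurent polynomial notation this is $\sum_a f_a x^a (1 + x^w)^{e(a)}$.\<close>

definition thicken :: "latN \<Rightarrow> lpoly \<Rightarrow> (latN \<Rightarrow> nat) \<Rightarrow> lpoly" where
  "thicken w f e n = (\<Sum>a\<in>supp f. emb w a (smult (f a) ([:1, 1:] ^ e a)) n)"

lemma pairing_ray: "pairing u w = 0 \<Longrightarrow> pairing u (ray w a l) = pairing u a"
  by (simp add: pairing_def ray_def algebra_simps) (metis distrib_left mult.left_commute mult_zero_right)

lemma phi_emb:
  assumes "emb w a P n \<noteq> 0" and "w \<noteq> (0, 0)" and "pairing (fst m) w = 0"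
  shows "phi m n = phi m a"
  using assms by (auto elim!: emb_nonzeroE simp: phi_def pairing_ray)

text \<open>Since \<open>u\<close> is \<open>w\<close> after a quarter turn, lines in direction
  \<open>w\<close> are levels of \<open>pairing u\<close>. By \<open>inj\<close> the exponents of
  \<open>f\<close> lie on different lines, which excludes cancellation in
  \<open>thicken\<close>.\<close>

locale level_separated =
  fixes w :: latN and f :: lpoly and u :: latM
  assumes prim: "gcd (fst w) (snd w) = 1" and fin: "finite (supp f)"
    and u_perp: "u = (snd w, - fst w)" and inj: "inj_on (pairing u) (supp f)"
begin

lemma w: "w \<noteq> (0, 0)"
  using prim by auto

lemma u: "pairing u w = 0"
  by (simp add: pairing_def u_perp)

lemma thicken_ray:
  assumes "a \<in> supp f"
  shows "thicken w f e (ray w a l) = f a * of_nat (e a choose l)"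
proof -
  have "emb w b P (ray w a l) = 0" if "b \<in> supp f" "b \<noteq> a" for b P
  proof (rule ccontr)
    assume "emb w b P (ray w a l) \<noteq> 0"
    then obtain k where "ray w a l = ray w b k"
      using w by (rule emb_nonzeroE)
    then have "pairing u a = pairing u b"
      using u pairing_ray by metis
    then show False
      using inj assms that by (auto dest: inj_onD)
  qed
  then have "thicken w f e (ray w a l) =
      (\<Sum>b\<in>{a}. emb w b (smult (f b) ([:1, 1:] ^ e b)) (ray w a l))"
    unfolding thicken_def using assms fin by (intro sum.mono_neutral_right) auto
  then show ?thesis
    using w by (simp add: coeff_binomial_power)
qed

lemma supp_thicken: "supp (thicken w f e) = {ray w a l | a l. a \<in> supp f \<and> l \<le> e a}"
proof (intro equalityI subsetI)
  fix n assume n: "n \<in> supp (thicken w f e)"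
  then obtain a where a: "a \<in> supp f" "emb w a (smult (f a) ([:1, 1:] ^ e a)) n \<noteq> 0"
    unfolding supp_def thicken_def by (auto elim: sum.not_neutral_contains_not_neutral)
  then obtain l where l: "n = ray w a l"
    using w by (auto elim: emb_nonzeroE)
  then have "e a choose l \<noteq> 0"
    using n thicken_ray[OF a(1)] by (auto simp: supp_def)
  then have "l \<le> e a"
    by (metis binomial_eq_0 not_le)
  then show "n \<in> {ray w a l | a l. a \<in> supp f \<and> l \<le> e a}"
    using a l by blast
next
  fix n assume "n \<in> {ray w a l | a l. a \<in> supp f \<and> l \<le> e a}"
  then show "n \<in> supp (thicken w f e)"
    by (auto simp: supp_def[of "thicken w f e"] thicken_ray) (auto simp: supp_def)
qed

text \<open>Lets a chain of mutations between thickenings start at \<open>f\<close> itself.\<close>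

lemma thicken_0: "thicken w f (\<lambda>_. 0) = f"
proof
  fix n
  have e: "emb w a [:c:] n = (if n = a then c else 0)" for a c
    using emb_monom[OF w, of a c 0 n] by (simp add: ray_def monom_0)
  have "thicken w f (\<lambda>_. 0) n = (\<Sum>a\<in>supp f. if n = a then f a else 0)"
    unfolding thicken_def by (simp add: e)
  also have "\<dots> = f n"
    using fin by (auto simp: sum.delta' supp_def)
  finally show "thicken w f (\<lambda>_. 0) n = f n" .
qed

section \<open>Mutations between thickenings\<close>

lemma inj_on_phi:
  assumes "fst m = u \<or> fst m = (- fst u, - snd u)"
  shows "inj_on (phi m) (supp f)"
proof (rule inj_onI)
  fix a b assume ab: "a \<in> supp f" "b \<in> supp f" "phi m a = phi m b"
  then have "pairing u a = pairing u b"
    using assms by (auto simp: phi_def pairing_def)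
  then show "a = b"
    using inj ab(1,2) by (auto dest: inj_onD)
qed

text \<open>Here \<open>phi m\<close> is constant along \<open>w\<close> and injective on
  \<open>supp f\<close>, so a level meets the line of only one exponent.\<close>

lemma piece_thicken:
  assumes m: "fst m = u \<or> fst m = (- fst u, - snd u)" and a: "a \<in> supp f"
  shows "piece (thicken w f e) m (phi m a) = emb w a (smult (f a) ([:1, 1:] ^ e a))"
proof
  fix n
  have mw: "pairing (fst m) w = 0"
    using m u by (auto simp: pairing_def)
  have b: "b = a" if "b \<in> supp f" "phi m b = phi m a" for b
    using inj_onD[OF inj_on_phi[OF m]] that a by blast
  show "piece (thicken w f e) m (phi m a) n = emb w a (smult (f a) ([:1, 1:] ^ e a)) n"
  proof (cases "phi m n = phi m a")
    case True
    have "thicken w f e n = (\<Sum>b\<in>{a}. emb w b (smult (f b) ([:1, 1:] ^ e b)) n)"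
      unfolding thicken_def
    proof (intro sum.mono_neutral_right ballI)
      fix c assume c: "c \<in> supp f - {a}"
      show "emb w c (smult (f c) ([:1, 1:] ^ e c)) n = 0"
      proof (rule ccontr)
        assume "emb w c (smult (f c) ([:1, 1:] ^ e c)) n \<noteq> 0"
        then have "phi m n = phi m c"
          by (rule phi_emb[OF _ w mw])
        then show False
          using b[of c] c True by auto
      qed
    qed (use a fin in auto)
    then show ?thesis
      using True by (simp add: piece_def)
  next
    case False
    then have "emb w a (smult (f a) ([:1, 1:] ^ e a)) n = 0"
      using phi_emb[OF _ w mw] by metis
    then show ?thesis
      using False by (simp add: piece_def)
  qed
qed

lemma phi_supp_thicken:
  assumes m: "fst m = u \<or> fst m = (- fst u, - snd u)"
  shows "phi m ` supp (thicken w f e) = phi m ` supp f"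
proof -
  have mw: "pairing (fst m) w = 0"
    using m u by (auto simp: pairing_def)
  have phi: "phi m (ray w a l) = phi m a" for a l
    by (simp add: phi_def pairing_ray[OF mw])
  have "a = ray w a 0" for a
    by (simp add: ray_def)
  then show ?thesis
    unfolding supp_thicken by (fastforce simp: phi image_iff)
qed

text \<open>Mutating with the factor \<open>1 + x^w\<close> changes its power at the level through
  \<open>a\<close> by \<open>- phi m a\<close>. That \<open>e'\<close> takes natural values
  guarantees the required divisibility.\<close>

lemma mut_step_thicken:
  assumes m: "fst m = u \<or> fst m = (- fst u, - snd u)"
    and e': "\<And>a. a \<in> supp f \<Longrightarrow> int (e' a) = int (e a) - phi m a"
  shows "mut_step (thicken w f e) (thicken w f e')"
proof -
  define g where "g = emb w (0, 0) [:1, 1:]"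
  have mw: "pairing (fst m) w = 0"
    using m u by (auto simp: pairing_def)
  have u0: "u \<noteq> (0, 0)"
    using w by (auto simp: u_perp prod_eq_iff)
  have ray01: "ray w (0, 0) 0 = (0, 0)" "ray w (0, 0) 1 = w"
    by (auto simp: ray_def)
  have g_vals: "g (0, 0) = 1" "g w = 1"
    using emb_ray[OF w, of "(0, 0)" "[:1, 1:]" 0] emb_ray[OF w, of "(0, 0)" "[:1, 1:]" 1]
    unfolding ray01 g_def by auto
  have supp_g: "supp g = {(0, 0), w}"
  proof
    have "degree [:1, 1::complex:] = 1" by simp
    then show "supp g \<subseteq> {(0, 0), w}"
      using supp_emb[OF w, of "(0, 0)" "[:1, 1:]"] ray01
      unfolding g_def by (auto simp: atMost_Suc)
    show "{(0, 0), w} \<subseteq> supp g"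
      using g_vals by (auto simp: supp_def)
  qed
  have "admissible m g"
    unfolding admissible_def
  proof (intro conjI)
    show "\<forall>k. m \<noteq> ((0, 0), k)"
      using m u0 by (auto simp: prod_eq_iff)
    show "is_lpoly g"
      by (simp add: is_lpoly_def supp_g)
    show "normalized g"
      unfolding normalized_def
    proof (intro allI impI)
      fix v assume "to_real v extreme_point_of newton g"
      then have "to_real v \<in> to_real ` supp g"
        unfolding newton_def by (rule extreme_point_of_convex_hull)
      then show "g v = 1"
        using g_vals supp_g by auto
    qed
    show "unit_segment g"
      unfolding unit_segment_def newton_def supp_g
      using w prim by (intro exI[of _ "(0, 0)"] exI[of _ w]) auto
    have "to_real x \<in> ker_hyp m" if "pairing (fst m) x = 0" for x
    proof -
      have "real_of_int (pairing (fst m) x) = 0"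
        using that by simp
      then show ?thesis
        by (simp add: ker_hyp_def to_real_def pairing_def)
    qed
    moreover have "convex (ker_hyp m)"
      using convex_hyperplane[of "(real_of_int (fst (fst m)), real_of_int (snd (fst m)))" 0]
      by (simp add: ker_hyp_def inner_prod_def)
    ultimately show "newton g \<subseteq> ker_hyp m"
      unfolding newton_def supp_g using mw
      by (intro hull_minimal) (auto simp: pairing_def)
  qed
  \<comment> \<open>The quotients are taken from the target, so divisibility reduces to adding
    exponents.\<close>
  define hs where "hs i = piece (thicken w f e') m i" for i
  have pow: "lpow g k = emb w (0, 0) ([:1, 1:] ^ k)" for k
    unfolding g_def by (simp add: lpow_emb[OF w])
  have up: "is_lpoly (hs i) \<and> piece (thicken w f e) m i = lmult (lpow g (nat i)) (hs i)"
    if "i \<ge> 0" for i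
  proof (cases "i \<in> phi m ` supp f")
    case True
    then obtain a where a: "a \<in> supp f" "i = phi m a" by blast
    have "e a = nat i + e' a"
      using e'[OF a(1)] a(2) that by linarith
    then show ?thesis
      unfolding hs_def a(2) piece_thicken[OF m a(1)] pow
      by (simp add: lmult_emb_emb[OF w] is_lpoly_emb[OF w] a(2)[symmetric] power_add)
  next
    case False
    then have "i \<notin> phi m ` supp (thicken w f e)" for e
      by (simp add: phi_supp_thicken[OF m])
    then have "piece (thicken w f e) m i = (\<lambda>_. 0)" for e
      by (fastforce simp: piece_def supp_def)
    then show ?thesis
      unfolding hs_def by (simp add: is_lpoly_def supp_def lmult_def)
  qed
  then have "mutable_wrt m g (thicken w f e)"
    unfolding mutable_wrt_def ldvd_def by blast
  moreover have "is_mutation m g (thicken w f e) (thicken w f e')"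
    unfolding is_mutation_def
  proof (intro exI[of _ hs] conjI allI impI)
    have val: "(if phi m a \<ge> 0 then hs (phi m a)
        else lmult (piece (thicken w f e) m (phi m a)) (lpow g (nat (- phi m a))))
        = emb w a (smult (f a) ([:1, 1:] ^ e' a))" if a: "a \<in> supp f" for a
    proof (cases "phi m a \<ge> 0")
      case True
      then show ?thesis
        by (simp add: hs_def piece_thicken[OF m a])
    next
      case False
      then have "e' a = e a + nat (- phi m a)"
        using e'[OF a] by linarith
      then show ?thesis
        using False by (simp add: piece_thicken[OF m a] pow lmult_emb_emb[OF w] power_add)
    qed
    show "thicken w f e' = lsum (phi m ` supp (thicken w f e))
        (\<lambda>i. if i \<ge> 0 then hs i
          else lmult (piece (thicken w f e) m i) (lpow g (nat (- i))))"
      unfolding phi_supp_thicken[OF m] lsum_def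
      by (rule ext) (simp add: sum.reindex[OF inj_on_phi[OF m]] val thicken_def[of w f e'])
  qed (use up in auto)
  ultimately show ?thesis
    using \<open>admissible m g\<close> unfolding mut_step_def by blast
qed

text \<open>Raise the exponents by mutating towards $-u$, then equalise them by mutating back with a
  shifted affine part.\<close>

lemma mutation_equivalent_thicken_const:
  "mutation_equivalent f (thicken w f (\<lambda>_. j))"
proof -
  have neg: "pairing (- fst u, - snd u) a = - pairing u a" for a
    by (simp add: pairing_def)
  define M where "M = Max (insert 0 (pairing u ` supp f))"
  have M: "pairing u a \<le> M" if "a \<in> supp f" for a
    unfolding M_def using fin that by (intro Max_ge insertI2 imageI) simp_all
  define e where "e a = nat (M - pairing u a)" for a
  \<comment> \<open>At \<open>a\<close> the first step has \<open>phi\<close> equal to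
    \<open>pairing u a - M \<le> 0\<close>, so the exponent grows from 0 to \<open>e a\<close>. The
    second has \<open>phi\<close> equal to \<open>e a - j\<close> and leaves
    \<open>j\<close>.\<close>
  have "mut_step (thicken w f (\<lambda>_. 0)) (thicken w f e)"
    by (rule mut_step_thicken[where m = "(u, - M)"])
      (simp_all add: phi_def e_def M)
  moreover have "mut_step (thicken w f e) (thicken w f (\<lambda>_. j))"
    by (rule mut_step_thicken[where m = "((- fst u, - snd u), M - int j)"])
      (simp_all add: phi_def e_def M neg)
  ultimately show ?thesis
    unfolding mutation_equivalent_def thicken_0 by (meson converse_rtranclp_into_rtranclp r_into_rtranclp)
qed

section \<open>The bound at the good point\<close>

text \<open>As \<open>w\<close> is primitive, Bezout coefficients produce the multiplier
  \<open>D\<close> directly as an integer.\<close>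

lemma orthogonal_w_imp_multiple:
  assumes "pairing U w = 0"
  shows "\<exists>D. U = (D * snd w, - D * fst w)"
proof -
  obtain x y where xy: "x * fst w + y * snd w = (1::int)"
    using bezout_int prim by metis
  have perp: "fst U * fst w = - (snd U * snd w)"
    using assms by (simp add: pairing_def)
  let ?D = "y * fst U - x * snd U"
  have "fst U = fst U * (x * fst w + y * snd w)"
    by (simp add: xy)
  also have "\<dots> = x * (fst U * fst w) + y * fst U * snd w"
    by (simp add: algebra_simps)
  also have "\<dots> = ?D * snd w"
    unfolding perp by (simp add: algebra_simps)
  finally have 1: "fst U = ?D * snd w" .
  have "snd U = snd U * (x * fst w + y * snd w)"
    by (simp add: xy)
  also have "\<dots> = x * snd U * fst w + y * (snd U * snd w)"
    by (simp add: algebra_simps)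
  also have "snd U * snd w = - (fst U * fst w)"
    using perp by simp
  also have "x * snd U * fst w + y * - (fst U * fst w) = - ?D * fst w"
    by (simp add: algebra_simps)
  finally show ?thesis
    using 1 by (metis prod.collapse)
qed

lemma phi_ray: "phi m (ray w a l) = phi m a + int l * pairing (fst m) w"
  by (simp add: phi_def ray_def pairing_def algebra_simps)

text \<open>The bounds on \<open>s\<close> keep \<open>v\<close> at least \<open>B\<close> steps of
  \<open>w\<close> from either end of the strip, and \<open>vu\<close> keeps it at least
  \<open>j\<close> levels of \<open>u\<close> from both extremes. A maximum \<open>t > 0\<close>
  satisfies \<open>t \<le> B\<close> if \<open>phi m\<close> varies along \<open>w\<close> and
  \<open>t \<le> int j\<close> otherwise, so one of these margins absorbs it.\<close>

lemma phi_thicken_good_point: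
  assumes p: "p \<in> supp f" and q: "q \<in> supp f"
    and B: "B \<ge> 0" "\<And>a b. a \<in> supp f \<Longrightarrow> b \<in> supp f \<Longrightarrow>
      \<bar>fst a - fst b\<bar> \<le> B \<and> \<bar>snd a - snd b\<bar> \<le> B"
    and v: "to_real v = (1 - r) *\<^sub>R to_real p + r *\<^sub>R to_real q + s *\<^sub>R to_real w"
    and r: "0 \<le> r" "r \<le> 1" and s: "of_int B \<le> s" "s \<le> of_int (int j - B)"
    and vu: "pairing u p + int j \<le> pairing u v" "pairing u v + int j \<le> pairing u q"
    and m: "m_mutable (thicken w f (\<lambda>_. j)) m"
  shows "phi m v \<le> 0"
proof -
  define G where "G = thicken w f (\<lambda>_. j)"
  have supp_G: "supp G = {ray w a l | a l. a \<in> supp f \<and> l \<le> j}"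
    unfolding G_def by (rule supp_thicken)
  define c where "c = pairing (fst m) w"
  have phi_ray': "phi m (ray w a l) = phi m a + int l * c" for a l
    by (simp add: phi_ray c_def)
  have "finite (supp G)"
  proof -
    have "supp G = (\<lambda>(a, l). ray w a l) ` (supp f \<times> {..j})"
      unfolding supp_G by auto
    then show ?thesis
      using fin by simp
  qed
  moreover have "supp G \<noteq> {}"
    unfolding supp_G using p by blast
  ultimately obtain n where n: "n \<in> supp G" "\<And>x. x \<in> supp G \<Longrightarrow> phi m x \<le> phi m n"
    using finite_ex_maximal[of "supp G" "phi m"] by blast
  define t where "t = phi m n"
  have t: "phi m a + int l * c \<le> t" if "a \<in> supp f" "l \<le> j" for a l
    unfolding t_def phi_ray'[symmetric] using that unfolding supp_G by (intro n(2)[unfolded supp_G]) blast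
  have t0: "phi m a \<le> t" and tj: "phi m a + int j * c \<le> t" if "a \<in> supp f" for a
    using t[OF that, of 0] t[OF that, of j] by auto
  \<comment> \<open>\<open>X\<close> is the value of \<open>phi m\<close> on the segment from
    \<open>p\<close> to \<open>q\<close>, \<open>s\<close> steps of \<open>w\<close> before
    \<open>v\<close>. The value changes by \<open>c\<close> per step and is at most \<open>t\<close>
    after 0 steps (\<open>X0\<close>) and after \<open>j\<close> steps (\<open>Xj\<close>).\<close>
  define X where "X = (1 - r) * of_int (phi m p) + r * of_int (phi m q)"
  have phi_v: "of_int (phi m v) = X + s * of_int c"
  proof -
    have "of_int (fst v) = (1 - r) * of_int (fst p) + r * of_int (fst q) + s * of_int (fst w)"
      and "of_int (snd v) = (1 - r) * of_int (snd p) + r * of_int (snd q) + s * of_int (snd w)"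
      using v by (auto simp: to_real_def)
    then show ?thesis
      by (simp add: X_def phi_def c_def pairing_def) (simp add: algebra_simps)
  qed
  have X0: "X \<le> of_int t"
  proof -
    have "X \<le> (1 - r) * of_int t + r * of_int t"
      unfolding X_def using r t0[OF p] t0[OF q] by (intro add_mono mult_left_mono) auto
    then show ?thesis
      by (simp add: algebra_simps)
  qed
  have Xj: "X + of_int j * of_int c \<le> of_int t"
  proof -
    have "X + of_int j * of_int c =
        (1 - r) * of_int (phi m p + int j * c) + r * of_int (phi m q + int j * c)"
      by (simp add: X_def algebra_simps)
    also have "\<dots> \<le> (1 - r) * of_int t + r * of_int t"
      using r tj[OF p] tj[OF q] by (intro add_mono mult_left_mono) (simp_all only: of_int_le_iff diff_ge_0_iff_ge)
    finally show ?thesis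
      by (simp add: algebra_simps)
  qed
  have sB: "0 \<le> s" "s \<le> of_int j" "of_int B \<le> of_int j - s"
    using s B(1) by auto
  show ?thesis
  proof (cases "t \<le> 0")
    case True
    have "X + s * of_int c \<le> of_int t"
    proof (cases "c \<ge> 0")
      case True
      then have "s * of_int c \<le> of_int j * of_int c"
        using sB by (intro mult_right_mono) auto
      then show ?thesis
        using Xj by linarith
    next
      case False
      then have "s * of_int c \<le> 0"
        using sB by (intro mult_nonneg_nonpos) auto
      then show ?thesis
        using X0 by linarith
    qed
    then have "phi m v \<le> t"
      unfolding phi_v[symmetric] by simp
    then show ?thesis
      using True by simp
  next
    case False
    then obtain d z z' where d: "d \<noteq> (0, 0)" "pairing (fst m) d = 0" "fst m \<noteq> (0, 0)"
      and z: "z \<in> supp G" "z' \<in> supp G" "phi m z = t" "phi m z' = t"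
      and spread: "pairing d z - pairing d z' \<ge> t * pairing d d"
      using m_mutable_spread[OF m[folded G_def] n(1)] unfolding t_def by (metis not_le)
    obtain a l a' l' where al: "z = ray w a l" "a \<in> supp f" "l \<le> j"
      and al': "z' = ray w a' l'" "a' \<in> supp f" "l' \<le> j"
      using z(1,2) unfolding supp_G by blast
    have za: "phi m a + int l * c = t" "phi m a' + int l' * c = t"
      using z(3,4) unfolding al al' phi_ray' .
    show ?thesis
    proof (cases "c = 0")
      case False
      \<comment> \<open>The face is a translate of a face of \<open>f\<close>, so its length is at most \<open>B\<close>.\<close>
      have "l = l'"
      proof (cases "c > 0")
        \<comment> \<open>A positive slope \<open>c\<close> puts the maximum at the last point of
          each ray, a negative one at the first.\<close>
        case True
        have "l = j" "l' = j"
          using za tj[OF al(2)] tj[OF al'(2)] True al(3) al'(3)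
          by (smt (verit) mult_less_cancel_right nat_int of_nat_less_iff le_neq_implies_less)+
        then show ?thesis by simp
      next
        case neg: False
        have "l = 0" "l' = 0"
          using za t0[OF al(2)] t0[OF al'(2)] neg False
          by (smt (verit) mult_pos_neg of_nat_0_less_iff neq0_conv)+
        then show ?thesis by simp
      qed
      then have "pairing d z - pairing d z' = fst d * (fst a - fst a') + snd d * (snd a - snd a')"
        by (simp add: al al' pairing_def ray_def algebra_simps)
      also have "\<dots> \<le> \<bar>fst d\<bar> * B + \<bar>snd d\<bar> * B"
      proof (intro add_mono)
        have "x * y \<le> \<bar>x\<bar> * B" if "\<bar>y\<bar> \<le> B" for x y :: int
          using abs_ge_self[of "x * y"] mult_left_mono[OF that, of "\<bar>x\<bar>"] by (simp add: abs_mult)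
        then show "fst d * (fst a - fst a') \<le> \<bar>fst d\<bar> * B" "snd d * (snd a - snd a') \<le> \<bar>snd d\<bar> * B"
          using B(2)[OF al(2) al'(2)] by blast+
      qed
      finally have 1: "t * pairing d d \<le> (\<bar>fst d\<bar> + \<bar>snd d\<bar>) * B"
        using spread by (simp add: algebra_simps)
      \<comment> \<open>This bounds \<open>pairing d d\<close> below by the sum of the absolute
        values of the entries of \<open>d\<close>, which then cancels and leaves
        \<open>t \<le> B\<close>.\<close>
      have sq: "\<bar>x\<bar> \<le> x * x" for x :: int
        using mult_right_mono[of 1 "\<bar>x\<bar>" "\<bar>x\<bar>"] by (cases "x = 0") (auto simp: abs_mult_self_eq)
      have "t * (\<bar>fst d\<bar> + \<bar>snd d\<bar>) \<le> t * pairing d d"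
        using sq[of "fst d"] sq[of "snd d"] \<open>\<not> t \<le> 0\<close>
        by (intro mult_left_mono) (auto simp: pairing_def)
      with 1 have "(\<bar>fst d\<bar> + \<bar>snd d\<bar>) * t \<le> (\<bar>fst d\<bar> + \<bar>snd d\<bar>) * B"
        by (simp add: mult.commute)
      moreover have "\<bar>fst d\<bar> + \<bar>snd d\<bar> > 0"
        using d(1) by (auto simp: prod_eq_iff)
      ultimately have tB: "of_int t \<le> (of_int B :: real)"
        by (simp add: mult_le_cancel_left_pos)
      \<comment> \<open>Since \<open>c\<close> is a nonzero integer, every step of \<open>w\<close>
        away from the maximal side lowers the value by at least 1, and \<open>v\<close> is at least
        \<open>B \<ge> t\<close> steps away.\<close>
      have "X + s * of_int c \<le> 0"
      proof (cases "c > 0")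
        case True
        then have "(of_int j - s) * 1 \<le> (of_int j - s) * of_int c"
          using sB by (intro mult_left_mono) auto
        then show ?thesis
          using Xj sB tB by (simp add: algebra_simps)
      next
        case neg: False
        then have "real_of_int c \<le> - 1"
          using \<open>c \<noteq> 0\<close> by linarith
        then have "s * of_int c \<le> s * (- 1)"
          using sB by (intro mult_left_mono) auto
        then show ?thesis
          using X0 s tB by linarith
      qed
      then show ?thesis
        unfolding phi_v[symmetric] by simp
    next
      case True
      \<comment> \<open>The face is parallel to \<open>w\<close>, hence has length \<open>j\<close>.\<close>
      obtain D where D: "fst m = (D * snd w, - D * fst w)"
        using orthogonal_w_imp_multiple True unfolding c_def by blast
      have phi_D: "phi m x = D * pairing u x + snd m" for x
        by (simp add: phi_def D pairing_def u_perp algebra_simps)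
      have "D \<noteq> 0"
        using d(3) D by auto
      \<comment> \<open>The quarter turn of \<open>d\<close> is orthogonal to \<open>w\<close>, so
        the lemma that gave \<open>D\<close> also shows that \<open>d\<close> is a multiple of
        \<open>w\<close>.\<close>
      then have "pairing (snd d, - fst d) w = 0"
        using d(2) by (simp add: D pairing_def algebra_simps)
      then obtain E where "(snd d, - fst d) = (E * snd w, - E * fst w)"
        using orthogonal_w_imp_multiple by blast
      then have E: "d = (E * fst w, E * snd w)"
        by (simp add: prod_eq_iff)
      have "E \<noteq> 0"
        using d(1) E by auto
      have "pairing u a = pairing u a'"
      proof -
        have "phi m a = phi m a'"
          using za True by simp
        then have "D * pairing u a = D * pairing u a'"
          using phi_D[of a] phi_D[of a'] by linarith
        then show ?thesis
          using \<open>D \<noteq> 0\<close> by simp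
      qed
      then have "a = a'"
        using inj al(2) al'(2) by (auto dest: inj_onD)
      have ww: "pairing w w > 0"
        using w by (cases w) (auto simp: pairing_def sum_squares_gt_zero_iff)
      \<comment> \<open>Both points lie on one ray, at positions \<open>l\<close> and
        \<open>l'\<close> between 0 and \<open>j\<close>. As \<open>E\<close> is a nonzero integer,
        the spread then forces \<open>t \<le> int j\<close>.\<close>
      have "pairing d z - pairing d z' = ((int l - int l') * E) * pairing w w"
        by (simp add: al al' \<open>a = a'\<close> E pairing_def ray_def algebra_simps)
      moreover have "t * pairing d d = (t * (E * E)) * pairing w w"
        by (simp add: E pairing_def algebra_simps)
      ultimately have "(t * (E * E)) * pairing w w \<le> ((int l - int l') * E) * pairing w w"
        using spread by linarith
      then have "t * (E * E) \<le> (int l - int l') * E"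
        using ww by (rule mult_right_le_imp_le)
      also have "\<dots> \<le> \<bar>int l - int l'\<bar> * \<bar>E\<bar>"
        by (metis abs_ge_self abs_mult)
      also have "\<dots> \<le> int j * \<bar>E\<bar>"
        using al(3) al'(3) by (intro mult_right_mono) auto
      finally have "(t * \<bar>E\<bar>) * \<bar>E\<bar> \<le> int j * \<bar>E\<bar>"
        by (simp add: mult.assoc)
      then have "t * \<bar>E\<bar> \<le> int j"
        using \<open>E \<noteq> 0\<close> by (simp add: mult_le_cancel_right_pos)
      moreover have "t * 1 \<le> t * \<bar>E\<bar>"
        using \<open>E \<noteq> 0\<close> \<open>\<not> t \<le> 0\<close> by (intro mult_left_mono) auto
      ultimately have tj': "t \<le> int j" by linarith
      show ?thesis
      \<comment> \<open>The sign of \<open>D\<close> decides whether \<open>q\<close> or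
        \<open>p\<close> carries the larger value, which is at most \<open>t\<close>. Moving from
        there to \<open>v\<close> crosses at least \<open>j\<close> levels of \<open>u\<close>, each
        lowering \<open>phi m\<close> by at least 1.\<close>
      proof (cases "D > 0")
        case True
        have "D * (pairing u v + int j) \<le> D * pairing u q"
          using True vu(2) by (intro mult_left_mono) auto
        moreover have "1 * int j \<le> D * int j"
          using True by (intro mult_right_mono) auto
        ultimately show ?thesis
          using t0[OF q] tj' by (simp add: phi_D distrib_left)
      next
        case False
        then have "D * pairing u v \<le> D * (pairing u p + int j)"
          using vu(1) by (intro mult_left_mono_neg) auto
        moreover have "D * int j \<le> (- 1) * int j"
          using False \<open>D \<noteq> 0\<close> by (intro mult_right_mono) auto
        ultimately show ?thesis
          using t0[OF p] tj' by (simp add: phi_D distrib_left)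
      qed
    qed
  qed
qed

text \<open>Every exponent of \<open>f\<close> contributes a segment of \<open>j\<close> steps of
  \<open>w\<close>; sliding \<open>p\<close> and \<open>q\<close> by the same \<open>s\<close> and
  then mixing them stays in the hull.\<close>

lemma newton_thicken_point:
  assumes "p \<in> supp f" "q \<in> supp f" "0 \<le> r" "r \<le> 1" "0 \<le> s" "s \<le> real j"
  shows "(1 - r) *\<^sub>R to_real p + r *\<^sub>R to_real q + s *\<^sub>R to_real w
    \<in> newton (thicken w f (\<lambda>_. j))"
proof -
  have conv: "convex (newton (thicken w f (\<lambda>_. j)))"
    by (simp add: newton_def)
  have edge: "to_real a + s *\<^sub>R to_real w \<in> newton (thicken w f (\<lambda>_. j))" if "a \<in> supp f" for a
  proof (cases "j = 0")
    case True
    have "ray w a 0 \<in> supp (thicken w f (\<lambda>_. j))"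
      using that unfolding supp_thicken by blast
    then have "to_real (ray w a 0) \<in> newton (thicken w f (\<lambda>_. j))"
      unfolding newton_def by (intro hull_inc imageI)
    then show ?thesis
      using True assms(5,6) by (simp add: ray_def)
  next
    case False
    have "ray w a 0 \<in> supp (thicken w f (\<lambda>_. j))" "ray w a j \<in> supp (thicken w f (\<lambda>_. j))"
      using that unfolding supp_thicken by blast+
    then have ends: "to_real (ray w a 0) \<in> newton (thicken w f (\<lambda>_. j))"
        "to_real (ray w a j) \<in> newton (thicken w f (\<lambda>_. j))"
      unfolding newton_def by (blast intro: hull_inc)+
    have "to_real a + s *\<^sub>R to_real w
        = (1 - s / real j) *\<^sub>R to_real (ray w a 0) + (s / real j) *\<^sub>R to_real (ray w a j)"
      using False by (simp add: to_real_def ray_def prod_eq_iff field_simps)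
    then show ?thesis
      using convexD_alt[OF conv ends, of "s / real j"] False assms(5,6) by simp
  qed
  have "(1 - r) *\<^sub>R to_real p + r *\<^sub>R to_real q + s *\<^sub>R to_real w
      = (1 - r) *\<^sub>R (to_real p + s *\<^sub>R to_real w) + r *\<^sub>R (to_real q + s *\<^sub>R to_real w)"
    by (simp add: algebra_simps)
  then show ?thesis
    using convexD_alt[OF conv edge[OF assms(1)] edge[OF assms(2)] assms(3,4)] by simp
qed

end

section \<open>Choice of the direction and of the point\<close>

text \<open>A monomial has spread zero, while mutability at a positive height demands positive
  spread. This serves the case in which \<open>f\<close> is kept as it is.\<close>

lemma monomial_good_point:
  assumes "supp f = {p}" and "m_mutable f m"
  shows "phi m p \<le> 0"
proof (rule ccontr)
  assume pos: "\<not> phi m p \<le> 0"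
  have "p \<in> supp f"
    using assms(1) by simp
  from m_mutable_spread[OF assms(2) this] pos
  obtain d z z' where d: "d \<noteq> (0, 0)" "z \<in> supp f" "z' \<in> supp f"
      "pairing d z - pairing d z' \<ge> phi m p * pairing d d"
    by (metis not_le)
  moreover have "pairing d d > 0"
    using d(1) by (cases d) (auto simp: pairing_def sum_squares_gt_zero_iff)
  ultimately show False
    using pos assms(1) by (auto simp: mult_le_0_iff)
qed

theorem theorem7p5:
  fixes f :: lpoly
  assumes "is_lpoly f" and "normalized f" and "f \<noteq> (\<lambda>_. 0)"
  shows "\<exists>g. mutation_equivalent f g \<and>
           (\<exists>v :: latN. to_real v \<in> newton g \<and> (\<forall>m\<in>mutability_set g. phi m v \<le> 0))"
proof -
  have fin: "finite (supp f)"
    using assms(1) by (simp add: is_lpoly_def)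
  have ne: "supp f \<noteq> {}"
    using assms(3) by (auto simp: supp_def)
  define D where "D = (\<lambda>(a, b). \<bar>fst a - fst b\<bar> + \<bar>snd a - snd b :: int\<bar>) ` (supp f \<times> supp f)"
  define B where "B = Max (insert 0 D)"
  have "finite D"
    using fin by (simp add: D_def)
  then have B0: "B \<ge> 0"
    by (simp add: B_def)
  have B: "\<bar>fst a - fst b\<bar> \<le> B \<and> \<bar>snd a - snd b\<bar> \<le> B" if "a \<in> supp f" "b \<in> supp f" for a b
  proof -
    have "\<bar>fst a - fst b\<bar> + \<bar>snd a - snd b\<bar> \<in> D"
      unfolding D_def using that by force
    then have "\<bar>fst a - fst b\<bar> + \<bar>snd a - snd b\<bar> \<le> B"
      unfolding B_def using \<open>finite D\<close> by (intro Max_ge) auto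
    then show ?thesis by linarith
  qed
  \<comment> \<open>\<open>N > B\<close> lets \<open>u\<close> separate the exponents by at least
    \<open>N\<close>, so two or more exponents give a width whose half is at least
    \<open>2 * B + 1\<close>. The second entry of \<open>w\<close> is 1 modulo \<open>N\<close>,
    which makes \<open>w\<close> primitive.\<close>
  define N where "N = 4 * B + 4"
  define w where "w = (N, N * N + 1)"
  define u where "u = (N * N + 1, - N)"
  have N: "N > 0" "B < N"
    using B0 by (auto simp: N_def)
  have sep: "N \<le> \<bar>pairing u a - pairing u b\<bar>" if "a \<in> supp f" "b \<in> supp f" "a \<noteq> b" for a b
  proof -
    define x where "x = fst a - fst b"
    define y where "y = snd a - snd b"
    have xy: "\<bar>x\<bar> \<le> N - 1" "\<bar>y\<bar> \<le> N - 1"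
      using B[OF that(1,2)] N unfolding x_def y_def by auto
    have eq: "pairing u a - pairing u b = (N * N + 1) * x - N * y"
      by (simp add: pairing_def u_def x_def y_def algebra_simps)
    have "\<bar>N * y\<bar> \<le> N * (N - 1)"
      using mult_left_mono[OF xy(2), of N] N by (simp add: abs_mult)
    show ?thesis
    \<comment> \<open>If \<open>x\<close> is nonzero, the term in \<open>x\<close> has size at least
      \<open>N * N + 1\<close> and the term in \<open>y\<close> at most \<open>N * N - N\<close>.
      Otherwise the term in \<open>y\<close> alone has size at least \<open>N\<close>.\<close>
    proof (cases "x = 0")
      case True
      then have "\<bar>y\<bar> \<ge> 1"
        using that(3) by (auto simp: x_def y_def prod_eq_iff)
      then have "N * 1 \<le> N * \<bar>y\<bar>"
        using N by (intro mult_left_mono) auto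
      then show ?thesis
        using True N by (simp add: eq abs_mult)
    next
      case False
      then have "(N * N + 1) * 1 \<le> (N * N + 1) * \<bar>x\<bar>"
        using N by (intro mult_left_mono) auto
      then have "N * N + 1 \<le> \<bar>(N * N + 1) * x\<bar>"
        using N by (simp add: abs_mult)
      moreover have "N * (N - 1) = N * N - N"
        by (simp add: algebra_simps)
      ultimately show ?thesis
        using \<open>\<bar>N * y\<bar> \<le> N * (N - 1)\<close> unfolding eq by linarith
    qed
  qed
  interpret level_separated w f u
  proof
    have "gcd N (N * N + 1) = 1"
      by (metis gcd.commute gcd_add_mult gcd_1_int add.commute)
    then show "gcd (fst w) (snd w) = 1"
      by (simp add: w_def)
    show "inj_on (pairing u) (supp f)"
      using sep N by (fastforce intro: inj_onI)
  qed (use fin in \<open>simp_all add: u_def w_def\<close>)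
  obtain p where p: "p \<in> supp f" "\<And>a. a \<in> supp f \<Longrightarrow> pairing u p \<le> pairing u a"
    using finite_ex_maximal[OF fin ne, of "\<lambda>a. - pairing u a"] by auto
  obtain q where q: "q \<in> supp f" "\<And>a. a \<in> supp f \<Longrightarrow> pairing u a \<le> pairing u q"
    using finite_ex_maximal[OF fin ne, of "pairing u"] by auto
  show ?thesis
  proof (cases "p = q")
    case True
    then have "pairing u a = pairing u p" if "a \<in> supp f" for a
      using p(2)[OF that] q(2)[OF that] by simp
    then have "supp f = {p}"
      using inj p(1) by (auto dest: inj_onD)
    moreover from this have "to_real p \<in> newton f"
      by (simp add: newton_def)
    ultimately show ?thesis
      using monomial_good_point[of f p]
      by (intro exI[of _ f] conjI exI[of _ p]) (auto simp: mutation_equivalent_def mutability_set_def)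
  next
    case False
    define W where "W = pairing u q - pairing u p"
    have W: "N \<le> W"
      using sep[OF p(1) q(1) False] p(2)[OF q(1)] unfolding W_def by simp
    \<comment> \<open>Rounding down ensures that a level \<open>j\<close> above the lowest is still
      at least \<open>j\<close> below the highest.\<close>
    define j where "j = nat (W div 2)"
    have j: "2 * int j \<le> W" "2 * B + 1 \<le> int j"
      using W N B0 unfolding j_def N_def by auto
    \<comment> \<open>At this parameter the segment from \<open>p\<close> to \<open>q\<close> meets
      the level \<open>pairing u p + int j\<close>.\<close>
    define r where "r = of_int (int j) / real_of_int W"
    have r: "0 \<le> r" "r \<le> 1" "r * of_int W = of_int (int j)"
      using j W N by (auto simp: r_def field_simps)
    \<comment> \<open>\<open>(1, N)\<close> has pairing 1 with \<open>u\<close>, so \<open>p + j (1, N)\<close> lies on the line through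
      \<open>(1 - r) p + r q\<close> in direction \<open>w\<close>.\<close>
    define k where "k = (of_int (int j) - r * of_int (fst q - fst p)) / real_of_int N"
    \<comment> \<open>An integral shift by \<open>w\<close> keeps the point in the lattice and on
      its level; the ceiling brings \<open>s\<close> between \<open>B\<close> and
      \<open>B + 1\<close>.\<close>
    define l where "l = \<lceil>of_int B - k\<rceil>"
    define s where "s = k + of_int l"
    have s: "of_int B \<le> s" "s \<le> of_int B + 1"
      unfolding s_def l_def by linarith+
    define v where "v = (fst p + int j + l * fst w, snd p + int j * N + l * snd w)"
    have kN: "k * of_int N = of_int (int j) - r * of_int (fst q - fst p)"
      using N by (simp add: k_def)
    have "to_real v = (1 - r) *\<^sub>R to_real p + r *\<^sub>R to_real q + s *\<^sub>R to_real w"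
    proof -
      define x where "x = real_of_int (fst q - fst p)"
      define y where "y = real_of_int (snd q - snd p)"
      define n where "n = real_of_int N"
      have n: "n \<noteq> 0"
        using N by (simp add: n_def)
      have kn: "k * n = real j - r * x"
        using kN by (simp add: n_def x_def)
      have "real_of_int W = (n * n + 1) * x - n * y"
        by (simp add: W_def u_def pairing_def x_def y_def n_def algebra_simps)
      then have "real j = r * ((n * n + 1) * x - n * y)"
        using r(3) by simp
      then have rny: "r * (n * y) = (n * n + 1) * (r * x) - real j"
        by (simp add: algebra_simps)
      \<comment> \<open>The choice of \<open>k\<close> settles the first coordinate. The second
        follows because both points have the same level of \<open>u\<close>, after multiplication by
        \<open>n\<close>.\<close>
      have "n * (r * y + k * (n * n + 1)) = r * (n * y) + (k * n) * (n * n + 1)"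
        by (simp add: algebra_simps)
      also have "\<dots> = n * (real j * n)"
        unfolding kn rny by (simp add: algebra_simps)
      finally have snd_eq: "r * y + k * (n * n + 1) = real j * n"
        using n by simp
      have "real_of_int (fst v) = fst p + r * x + s * n"
        using kn by (simp add: v_def s_def w_def n_def algebra_simps)
      moreover have "real_of_int (snd v) = snd p + r * y + s * (n * n + 1)"
        using snd_eq by (simp add: v_def s_def w_def n_def algebra_simps)
      ultimately show ?thesis
        by (simp add: to_real_def w_def x_def y_def n_def algebra_simps)
    qed
    note v = this
    have "pairing u v = pairing u p + int j"
      by (simp add: v_def w_def u_def pairing_def algebra_simps)
    then have vu: "pairing u p + int j \<le> pairing u v" "pairing u v + int j \<le> pairing u q"
      using j(1) by (simp_all add: W_def)
    \<comment> \<open>This gives \<open>B + 1 \<le> int j - B\<close>, so \<open>s\<close> also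
      keeps its distance from the far end of the strip.\<close>
    have "real_of_int (2 * B + 1) \<le> real_of_int (int j)"
      using j(2) by (simp only: of_int_le_iff)
    then have s': "s \<le> of_int (int j - B)"
      using s(2) by simp
    have "0 \<le> s" "s \<le> real j"
      using s s' B0 by auto
    then have "to_real v \<in> newton (thicken w f (\<lambda>_. j))"
      unfolding v by (intro newton_thicken_point p(1) q(1) r(1,2))
    moreover have "phi m v \<le> 0" if "m_mutable (thicken w f (\<lambda>_. j)) m" for m
      by (rule phi_thicken_good_point[OF p(1) q(1) B0 B v r(1,2) s(1) s' vu that])
    ultimately show ?thesis
      using mutation_equivalent_thicken_const[of j] unfolding mutability_set_def by blast
  qed
qed

end
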